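(* Let $(X,G)$ be a complete $G$-metric space, let $p\ge 1$ be an integer, and let $A_1,\dots,A_p$ be non-empty closed subsets of $X$, with the convention $A_{p+1}=A_1$. Let $T:\bigcup_{i=1}^{p}A_i\to\bigcup_{i=1}^{p}A_i$ be a cyclical operator, i.e. $T(A_i)\subseteq A_{i+1}$ for all $i\in\{1,\dots,p\}$. Let $\phi:[0,\infty)\to[0,\infty)$ be an altering distance function and let $\psi:[0,\infty)^3\to[0,\infty)$ be a continuous function such that $\psi(x,y,z)=0$ if and only if $x=y=z=0$. Suppose that $T$ satisfies at least one of the following conditions. (1) There exist real constants $\alpha,\gamma$ with $0\le\gamma<1$ and $0<\alpha+\gamma\le 1$ such that for every $i\in\{1,\dots,p\}$ and all $x\in A_i$, $y\in A_{i+1}$, $$\phi\big(G(Tx,Ty,Ty)\big)\le \phi\big(\alpha G(x,Tx,Tx)+\gamma G(y,Ty,Ty)\big)-\psi\big(G(x,Tx,Tx),G(y,Ty,Ty),G(y,Ty,Ty)\big).$$ (2) There exist real constants $\alpha,\delta$ with $0\le\alpha\le\frac12$ and $0<\alpha+\delta\le 1$ such that for every $i\in\{1,\dots,p\}$ and all $x\in A_i$, $y\in A_{i+1}$, $$\phi\big(G(Tx,Ty,Ty)\big)\le \phi\big(\alpha G(x,Ty,Ty)+\delta G(y,y,Tx)\big)-\psi\big(G(x,Ty,Ty),G(y,y,Tx),G(y,y,Tx)\big).$$ Then $T$ has a unique fixed point $u$, and $u\in\bigcap_{i=1}^{p}A_i$.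
   Context: A $G$-metric on a non-empty set $X$ is a function $G:X\times X\times X\to[0,\infty)$ such that: (G1) $G(x,y,z)=0$ if $x=y=z$; (G2) $0<G(x,x,y)$ whenever $x\ne y$; (G3) $G(x,x,y)\le G(x,y,z)$ for all $x,y,z$ with $y\neq z$; (G4) $G$ is symmetric in all three variables; (G5) $G(x,y,z)\le G(x,a,a)+G(a,y,z)$ for all $x,y,z,a\in X$. The pair $(X,G)$ is then a $G$-metric space. A sequence $\{x_n\}$ is $G$-convergent to $x$ if $\lim_{n,m\to\infty}G(x,x_n,x_m)=0$, and it is $G$-Cauchy if $\lim_{n,m,\ell\to\infty}G(x_n,x_m,x_\ell)=0$. The space is complete if every $G$-Cauchy sequence in $X$ is $G$-convergent in $X$. A subset is closed if it contains the limits of all $G$-convergent sequences of its elements. An altering distance function is a function $\phi:[0,\infty)\to[0,\infty)$ that is continuous, nondecreasing, and satisfies $\phi(t)=0$ if and only if $t=0$. Since $\phi$ is defined only on $[0,\infty)$, each contractive inequality is understood to include the requirement that the argument of $\phi$ on its right-hand side be nonnegative. *)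

theory Defs
  imports "HOL-Analysis.Analysis"
begin

text \<open>
  Spaces are given by a carrier set \<open>X\<close> and a function \<open>G\<close> on the ambient type;
  only the values of \<open>G\<close> on \<open>X\<close> are constrained.
\<close>

definition G_metric_space :: "'a set \<Rightarrow> ('a \<Rightarrow> 'a \<Rightarrow> 'a \<Rightarrow> real) \<Rightarrow> bool" where
  "G_metric_space X G \<longleftrightarrow>
     X \<noteq> {} \<and>
     (\<forall>x\<in>X. \<forall>y\<in>X. \<forall>z\<in>X. 0 \<le> G x y z) \<and>
     (\<forall>x\<in>X. G x x x = 0) \<and>
     (\<forall>x\<in>X. \<forall>y\<in>X. x \<noteq> y \<longrightarrow> 0 < G x x y) \<and>
     (\<forall>x\<in>X. \<forall>y\<in>X. \<forall>z\<in>X. y \<noteq> z \<longrightarrow> G x x y \<le> G x y z) \<and>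
     (\<forall>x\<in>X. \<forall>y\<in>X. \<forall>z\<in>X. G x y z = G x z y \<and> G x y z = G y x z) \<and>
     (\<forall>x\<in>X. \<forall>y\<in>X. \<forall>z\<in>X. \<forall>a\<in>X. G x y z \<le> G x a a + G a y z)"

text \<open>Limits in several indices are joint limits, along the product filter.\<close>

definition G_converges :: "('a \<Rightarrow> 'a \<Rightarrow> 'a \<Rightarrow> real) \<Rightarrow> (nat \<Rightarrow> 'a) \<Rightarrow> 'a \<Rightarrow> bool" where
  "G_converges G s x \<longleftrightarrow>
     ((\<lambda>(n, m). G x (s n) (s m)) \<longlongrightarrow> 0) (sequentially \<times>\<^sub>F sequentially)"

definition G_Cauchy :: "('a \<Rightarrow> 'a \<Rightarrow> 'a \<Rightarrow> real) \<Rightarrow> (nat \<Rightarrow> 'a) \<Rightarrow> bool" where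
  "G_Cauchy G s \<longleftrightarrow>
     ((\<lambda>(n, m, l). G (s n) (s m) (s l)) \<longlongrightarrow> 0)
       (sequentially \<times>\<^sub>F sequentially \<times>\<^sub>F sequentially)"

definition G_complete :: "'a set \<Rightarrow> ('a \<Rightarrow> 'a \<Rightarrow> 'a \<Rightarrow> real) \<Rightarrow> bool" where
  "G_complete X G \<longleftrightarrow>
     (\<forall>s. (\<forall>n. s n \<in> X) \<longrightarrow> G_Cauchy G s \<longrightarrow> (\<exists>x\<in>X. G_converges G s x))"

definition G_closed :: "'a set \<Rightarrow> ('a \<Rightarrow> 'a \<Rightarrow> 'a \<Rightarrow> real) \<Rightarrow> 'a set \<Rightarrow> bool" where
  "G_closed X G A \<longleftrightarrow>
     A \<subseteq> X \<and> (\<forall>s x. (\<forall>n. s n \<in> A) \<longrightarrow> x \<in> X \<longrightarrow> G_converges G s x \<longrightarrow> x \<in> A)"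

text \<open>
  The family is indexed by \<open>1, \<dots>, p\<close>; the value at \<open>p + 1\<close> is also used and is
  to be identified with the value at \<open>1\<close> by the user of this definition.
\<close>

definition cyclical_operator :: "nat \<Rightarrow> (nat \<Rightarrow> 'a set) \<Rightarrow> ('a \<Rightarrow> 'a) \<Rightarrow> bool" where
  "cyclical_operator p A T \<longleftrightarrow>
     T ` (\<Union>i\<in>{1..p}. A i) \<subseteq> (\<Union>i\<in>{1..p}. A i) \<and>
     (\<forall>i\<in>{1..p}. T ` A i \<subseteq> A (i + 1))"

text \<open>
  Functions on \<open>[0,\<infinity>)\<close> are total functions on the reals whose values outside
  \<open>[0,\<infinity>)\<close> are irrelevant.
\<close>

definition altering_distance :: "(real \<Rightarrow> real) \<Rightarrow> bool" where
  "altering_distance \<phi> \<longleftrightarrow>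
     (\<forall>t\<ge>0. 0 \<le> \<phi> t) \<and>
     continuous_on {0..} \<phi> \<and>
     mono_on {0..} \<phi> \<and>
     (\<forall>t\<ge>0. \<phi> t = 0 \<longleftrightarrow> t = 0)"

end

theory Submission
  imports Defs
begin

text \<open>
  The function \<open>d x y = G x y y\<close> is a quasi-metric with \<open>d y x \<le> 2 d x y\<close>, and it carries all
  the information needed about \<open>G\<close>. Both conditions have the shape
  \<open>\<phi> (d (T x) (T y)) \<le> \<phi> (\<alpha> u + \<beta> v) - \<psi> u v v\<close>. Such an inequality forces
  \<open>d (T x) (T y) \<le> \<alpha> u + \<beta> v\<close>, and if it persists in a limit where \<open>\<alpha> u + \<beta> v\<close> is at most the
  left-hand distance, then \<open>u = v = 0\<close>. Along a Picard orbit this gives first that consecutive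
  distances decrease to \<open>0\<close>, then that points whose indices differ by \<open>1\<close> modulo \<open>p\<close> are
  close, so that the orbit is Cauchy. Its limit lies in every set of the cycle, and the same
  limit principle shows that it is the unique fixed point.
\<close>

section \<open>The quasi-metric of a G-metric space\<close>

locale G_space =
  fixes X :: "'a set" and G :: "'a \<Rightarrow> 'a \<Rightarrow> 'a \<Rightarrow> real"
  assumes G_metric: "G_metric_space X G"
begin

abbreviation d :: "'a \<Rightarrow> 'a \<Rightarrow> real" where
  "d x y \<equiv> G x y y"

lemma G_nonneg: "x \<in> X \<Longrightarrow> y \<in> X \<Longrightarrow> z \<in> X \<Longrightarrow> 0 \<le> G x y z"
  using G_metric by (simp add: G_metric_space_def)

lemma d_refl: "x \<in> X \<Longrightarrow> d x x = 0"
  using G_metric by (simp add: G_metric_space_def)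

lemma G_rotate: "x \<in> X \<Longrightarrow> y \<in> X \<Longrightarrow> G y y x = d x y"
  using G_metric unfolding G_metric_space_def by metis

lemma d_eq_0: "x \<in> X \<Longrightarrow> y \<in> X \<Longrightarrow> d x y = 0 \<Longrightarrow> x = y"
  using G_metric G_rotate unfolding G_metric_space_def by (metis less_irrefl)

lemma G_triangle: "x \<in> X \<Longrightarrow> y \<in> X \<Longrightarrow> z \<in> X \<Longrightarrow> a \<in> X \<Longrightarrow> G x y z \<le> d x a + G a y z"
  using G_metric unfolding G_metric_space_def by blast

lemma d_triangle: "x \<in> X \<Longrightarrow> y \<in> X \<Longrightarrow> a \<in> X \<Longrightarrow> d x y \<le> d x a + d a y"
  by (rule G_triangle)

text \<open>Inserting \<open>y\<close> as intermediate point leaves \<open>G y y z\<close>, which is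
  \<open>d z y\<close>. This is how three-variable estimates reduce to \<open>d\<close>.\<close>

lemma G_le_d: "x \<in> X \<Longrightarrow> y \<in> X \<Longrightarrow> z \<in> X \<Longrightarrow> G x y z \<le> d x y + d z y"
  using G_triangle[of x y z y] G_rotate[of z y] by simp

text \<open>Taking \<open>z = x\<close> in \<open>G_le_d\<close> bounds \<open>G x y x\<close>,
  which is \<open>d y x\<close> by symmetry of \<open>G\<close>.\<close>

lemma d_swap: "x \<in> X \<Longrightarrow> y \<in> X \<Longrightarrow> d y x \<le> 2 * d x y"
  using G_le_d[of x y x] G_rotate[of y x] G_metric unfolding G_metric_space_def
  by (smt (verit, best))

lemma d_tendsto_swap:
  assumes "\<And>n. x n \<in> X" "\<And>n. y n \<in> X" "((\<lambda>n. d (x n) (y n)) \<longlongrightarrow> 0) F"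
  shows "((\<lambda>n. d (y n) (x n)) \<longlongrightarrow> 0) F"
proof (rule tendsto_sandwich[where f = "\<lambda>_. 0"])
  show "((\<lambda>n. 2 * d (x n) (y n)) \<longlongrightarrow> 0) F"
    using tendsto_mult_left[OF assms(3), of 2] by simp
qed (use assms(1,2) G_nonneg d_swap in auto)

text \<open>Moving both endpoints by vanishing amounts does not change the limit of the distance:
  the triangle inequality squeezes it from both sides. As \<open>d\<close> is not symmetric, the
  displacements are needed in both directions.\<close>

lemma d_tendsto_cong:
  assumes X: "\<And>n. x n \<in> X" "\<And>n. y n \<in> X" "\<And>n. x' n \<in> X" "\<And>n. y' n \<in> X"
    and x: "((\<lambda>n. d (x n) (x' n)) \<longlongrightarrow> 0) F" and y: "((\<lambda>n. d (y n) (y' n)) \<longlongrightarrow> 0) F"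
    and L: "((\<lambda>n. d (x n) (y n)) \<longlongrightarrow> L) F"
  shows "((\<lambda>n. d (x' n) (y' n)) \<longlongrightarrow> L) F"
proof (rule tendsto_sandwich)
  note x' = d_tendsto_swap[OF X(1,3) x] and y' = d_tendsto_swap[OF X(2,4) y]
  show "((\<lambda>n. d (x n) (y n) - d (x n) (x' n) - d (y' n) (y n)) \<longlongrightarrow> L) F"
    using tendsto_diff[OF tendsto_diff[OF L x] y'] by simp
  show "((\<lambda>n. d (x' n) (x n) + d (x n) (y n) + d (y n) (y' n)) \<longlongrightarrow> L) F"
    using tendsto_add[OF tendsto_add[OF x' L] y] by simp
  have "d (x n) (y n) \<le> d (x n) (x' n) + (d (x' n) (y' n) + d (y' n) (y n))" for n
    using d_triangle[of "x n" "y n" "x' n"] d_triangle[of "x' n" "y n" "y' n"] X by smt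
  then show "\<forall>\<^sub>F n in F. d (x n) (y n) - d (x n) (x' n) - d (y' n) (y n) \<le> d (x' n) (y' n)"
    by (smt (verit) always_eventually)
  have "d (x' n) (y' n) \<le> d (x' n) (x n) + (d (x n) (y n) + d (y n) (y' n))" for n
    using d_triangle[of "x' n" "y' n" "x n"] d_triangle[of "x n" "y' n" "y n"] X by smt
  then show "\<forall>\<^sub>F n in F. d (x' n) (y' n) \<le> d (x' n) (x n) + d (x n) (y n) + d (y n) (y' n)"
    by (smt (verit) always_eventually)
qed

lemma G_convergesD:
  assumes "G_converges G s x"
  shows "(\<lambda>n. d x (s n)) \<longlonglongrightarrow> 0"
proof -
  \<comment> \<open>The joint limit is restricted to the diagonal \<open>n = m\<close>.\<close>
  have "filterlim (\<lambda>n. (n, n)) (sequentially \<times>\<^sub>F sequentially) sequentially"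
    by (simp add: filterlim_Pair filterlim_ident)
  from filterlim_compose[OF assms[unfolded G_converges_def] this] show ?thesis by simp
qed

lemma G_converges_subseq:
  assumes "G_converges G s x" "filterlim r sequentially sequentially"
  shows "G_converges G (\<lambda>n. s (r n)) x"
proof -
  have "filterlim (\<lambda>z. (r (fst z), r (snd z))) (sequentially \<times>\<^sub>F sequentially)
          (sequentially \<times>\<^sub>F sequentially)"
    by (intro filterlim_Pair filterlim_compose[OF assms(2)] filterlim_fst filterlim_snd)
  from filterlim_compose[OF assms(1)[unfolded G_converges_def] this]
  show ?thesis by (simp add: G_converges_def case_prod_unfold)
qed

lemma G_CauchyI:
  assumes X: "\<And>n. s n \<in> X"
    and "\<And>e. e > 0 \<Longrightarrow> \<exists>N. \<forall>m\<ge>N. \<forall>n\<ge>N. d (s m) (s n) < e"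
  shows "G_Cauchy G s"
  unfolding G_Cauchy_def tendsto_iff
proof (intro allI impI)
  fix e :: real assume "e > 0"
  then obtain N where N: "\<And>m n. m \<ge> N \<Longrightarrow> n \<ge> N \<Longrightarrow> d (s m) (s n) < e / 2"
    using assms(2)[of "e / 2"] by auto
  have G: "G (s a) (s b) (s c) < e" if "a \<ge> N" "b \<ge> N" "c \<ge> N" for a b c
    using G_le_d[OF X X X, of a b c] N[of a b] N[of c b] that by linarith
  have N': "\<forall>\<^sub>F n in sequentially. n \<ge> N"
    by (rule eventually_ge_at_top)
  have "\<forall>\<^sub>F z in sequentially \<times>\<^sub>F sequentially \<times>\<^sub>F sequentially.
          fst z \<ge> N \<and> fst (snd z) \<ge> N \<and> snd (snd z) \<ge> N"
    using eventually_prodI[OF N' eventually_prodI[OF N' N']] by simp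
  then show "\<forall>\<^sub>F z in sequentially \<times>\<^sub>F sequentially \<times>\<^sub>F sequentially.
          dist (case z of (n, m, l) \<Rightarrow> G (s n) (s m) (s l)) 0 < e"
    by eventually_elim (auto simp: G G_nonneg X)
qed

end

section \<open>The contractive inequality\<close>

locale alteration =
  fixes \<phi> :: "real \<Rightarrow> real" and \<psi> :: "real \<Rightarrow> real \<Rightarrow> real \<Rightarrow> real" and \<alpha> \<beta> :: real
  assumes altering: "altering_distance \<phi>"
    and psi_nonneg: "\<And>x y z. x \<ge> 0 \<Longrightarrow> y \<ge> 0 \<Longrightarrow> z \<ge> 0 \<Longrightarrow> \<psi> x y z \<ge> 0"
    and psi_cont: "continuous_on ({0..} \<times> {0..} \<times> {0..}) (\<lambda>(x, y, z). \<psi> x y z)"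
    and psi_eq_0: "\<And>x y z. x \<ge> 0 \<Longrightarrow> y \<ge> 0 \<Longrightarrow> z \<ge> 0 \<Longrightarrow>
           \<psi> x y z = 0 \<longleftrightarrow> x = 0 \<and> y = 0 \<and> z = 0"
begin

text \<open>Both contractive conditions in one form: \<open>a\<close> is the distance of the images
  and \<beta> stands for \<gamma> or \<delta>. The sign conditions keep every argument of \<phi> and
  \<psi> inside its domain.\<close>

definition contr :: "real \<Rightarrow> real \<Rightarrow> real \<Rightarrow> bool" where
  "contr a u v \<longleftrightarrow> 0 \<le> a \<and> 0 \<le> u \<and> 0 \<le> v \<and> 0 \<le> \<alpha> * u + \<beta> * v \<and>
     \<phi> a \<le> \<phi> (\<alpha> * u + \<beta> * v) - \<psi> u v v"

lemma phi_mono: "0 \<le> a \<Longrightarrow> a \<le> b \<Longrightarrow> \<phi> a \<le> \<phi> b"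
  using altering by (auto simp: altering_distance_def mono_on_def)

lemma phi_tendsto:
  assumes "(a \<longlongrightarrow> l) F" "\<And>n. 0 \<le> a n" "0 \<le> l"
  shows "((\<lambda>n. \<phi> (a n)) \<longlongrightarrow> \<phi> l) F"
  by (rule continuous_on_tendsto_compose[of "{0..}" \<phi>])
    (use altering assms in \<open>auto simp: altering_distance_def\<close>)

text \<open>Monotonicity of \<phi> cancels the two \<phi>-terms, leaving \<open>\<psi> u v v\<close>
  at most 0.\<close>

lemma contr_zero:
  assumes "contr a u v" "\<alpha> * u + \<beta> * v \<le> a"
  shows "u = 0 \<and> v = 0"
proof -
  have "\<phi> (\<alpha> * u + \<beta> * v) \<le> \<phi> a"
    using assms by (intro phi_mono) (auto simp: contr_def)
  then have "\<psi> u v v \<le> 0" and nn: "0 \<le> u" "0 \<le> v"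
    using assms(1) by (auto simp: contr_def)
  then have "\<psi> u v v = 0"
    using psi_nonneg[OF nn(1) nn(2) nn(2)] by simp
  then show ?thesis
    using psi_eq_0[OF nn(1) nn(2) nn(2)] by simp
qed

text \<open>\<phi> need not be strictly increasing, so it cannot be cancelled directly. If
  \<open>a\<close> were larger, \<open>contr_zero\<close> would give \<open>u = v = 0\<close>, hence
  \<open>\<phi> a \<le> \<phi> 0 = 0\<close> and \<open>a = 0\<close>.\<close>

lemma contr_le:
  assumes "contr a u v"
  shows "a \<le> \<alpha> * u + \<beta> * v"
proof (rule ccontr)
  assume less: "\<not> ?thesis"
  with contr_zero[OF assms] have "u = 0" "v = 0" by auto
  with assms have "\<phi> a \<le> \<phi> 0" "a \<ge> 0"
    using psi_nonneg[of 0 0 0] by (auto simp: contr_def)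
  then have "a = 0"
    using altering unfolding altering_distance_def by (metis order_antisym order_refl)
  with less \<open>u = 0\<close> \<open>v = 0\<close> show False by simp
qed

text \<open>By continuity of \<phi> and \<psi> the contractive inequality survives the limit, where
  \<open>contr_zero\<close> applies.\<close>

lemma contr_lim:
  assumes c: "\<And>n :: nat. contr (a n) (u n) (v n)"
    and lims: "a \<longlonglongrightarrow> a'" "u \<longlonglongrightarrow> u'" "v \<longlonglongrightarrow> v'"
    and le: "\<alpha> * u' + \<beta> * v' \<le> a'"
  shows "u' = 0 \<and> v' = 0"
proof -
  have c': "0 \<le> a n" "0 \<le> u n" "0 \<le> v n" "0 \<le> \<alpha> * u n + \<beta> * v n"
    "\<phi> (a n) \<le> \<phi> (\<alpha> * u n + \<beta> * v n) - \<psi> (u n) (v n) (v n)" for n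
    using c[of n] by (auto simp: contr_def)
  have lin: "(\<lambda>n. \<alpha> * u n + \<beta> * v n) \<longlonglongrightarrow> \<alpha> * u' + \<beta> * v'"
    by (intro tendsto_intros lims)
  have "0 \<le> a'" "0 \<le> u'" "0 \<le> v'"
    using lims c' by (auto intro: LIMSEQ_le_const)
  moreover have "0 \<le> \<alpha> * u' + \<beta> * v'"
    by (rule LIMSEQ_le_const[OF lin]) (use c' in auto)
  ultimately have nn: "0 \<le> a'" "0 \<le> u'" "0 \<le> v'" "0 \<le> \<alpha> * u' + \<beta> * v'" .
  have "(\<lambda>n. (u n, v n, v n)) \<longlonglongrightarrow> (u', v', v')"
    by (intro tendsto_Pair lims)
  then have psi: "(\<lambda>n. \<psi> (u n) (v n) (v n)) \<longlonglongrightarrow> \<psi> u' v' v'"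
    using continuous_on_tendsto_compose[OF psi_cont,
        of "\<lambda>n. (u n, v n, v n)" "(u', v', v')" sequentially] nn c' by simp
  have "\<phi> a' \<le> \<phi> (\<alpha> * u' + \<beta> * v') - \<psi> u' v' v'"
    by (rule LIMSEQ_le[OF phi_tendsto[OF lims(1)] tendsto_diff[OF phi_tendsto[OF lin] psi]])
      (use c' nn in auto)
  with nn le show ?thesis
    by (intro contr_zero[of a']) (auto simp: contr_def)
qed

end

section \<open>Picard orbits of cyclical operators\<close>

text \<open>The cycle is unrolled into a \<open>p\<close>-periodic family over all naturals, so that
  \<open>s n\<close> lies in \<open>B n\<close> and no wrap-around case occurs in the
  arguments.\<close>

locale cyclic_orbit = G_space X G + alteration \<phi> \<psi> \<alpha> \<beta>
  for X :: "'a set" and G \<phi> \<psi> \<alpha> \<beta> +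
  fixes B :: "nat \<Rightarrow> 'a set" and T :: "'a \<Rightarrow> 'a" and p :: nat and s :: "nat \<Rightarrow> 'a"
  assumes complete: "G_complete X G"
    and p_pos: "p \<ge> 1"
    and closed: "\<And>n. G_closed X G (B n)"
    and periodic: "\<And>n. B (n + p) = B n"
    and T_B: "\<And>n x. x \<in> B n \<Longrightarrow> T x \<in> B (Suc n)"
    and s_0: "s 0 \<in> B 0"
    and s_Suc: "\<And>n. s (Suc n) = T (s n)"
begin

lemma B_X: "x \<in> B n \<Longrightarrow> x \<in> X"
  using closed[of n] by (auto simp: G_closed_def)

lemma T_X: "x \<in> B n \<Longrightarrow> T x \<in> X"
  using T_B B_X by blast

lemma s_B: "s n \<in> B n"
  by (induction n) (auto simp: s_0 s_Suc T_B)

lemma s_X: "s n \<in> X"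
  using s_B B_X by blast

lemma periodic_mult: "B (n + k * p) = B n"
proof (induction k)
  case (Suc k)
  then show ?case using periodic[of "n + k * p"] by (simp add: algebra_simps)
qed simp

lemma s_shift_B: "s (n + k * p) \<in> B n"
  using s_B[of "n + k * p"] periodic_mult by simp

section \<open>Vanishing steps, the Cauchy property and the limit of the orbit\<close>

lemma step_tendsto_mult:
  assumes "(\<lambda>n. d (s n) (s (Suc n))) \<longlonglongrightarrow> 0"
  shows "(\<lambda>n. d (s n) (s (n + j))) \<longlonglongrightarrow> 0"
proof (induction j)
  case 0
  then show ?case by (simp add: d_refl s_X)
next
  case (Suc j)
  have "(\<lambda>n. d (s (n + j)) (s (Suc (n + j)))) \<longlonglongrightarrow> 0"
    using LIMSEQ_ignore_initial_segment[OF assms, of j] by simp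
  from d_tendsto_cong[OF _ _ _ _ _ this Suc, where x' = s] show ?case
    by (simp add: s_X d_refl)
qed

text \<open>The limit \<open>r\<close> is not yet shown to be 0; each contractive condition does
  this by its own use of \<open>contr_lim\<close>.\<close>

lemma step_tendsto_0:
  assumes dec: "\<And>n. d (s (Suc n)) (s (Suc (Suc n))) \<le> d (s n) (s (Suc n))"
  obtains r where "r \<ge> 0" "(\<lambda>n. d (s n) (s (Suc n))) \<longlonglongrightarrow> r"
    "(\<lambda>n. d (s (Suc n)) (s (Suc (Suc n)))) \<longlonglongrightarrow> r"
proof -
  have "decseq (\<lambda>n. d (s n) (s (Suc n)))"
    using dec by (intro decseq_SucI)
  then obtain r where r: "(\<lambda>n. d (s n) (s (Suc n))) \<longlonglongrightarrow> r"
    by (rule decseq_convergent[where B = 0]) (auto simp: G_nonneg s_X)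
  moreover have "r \<ge> 0"
    using LIMSEQ_le_const[OF r] G_nonneg s_X by blast
  ultimately show ?thesis
    using that LIMSEQ_Suc[OF r] by blast
qed

text \<open>The contractive conditions compare only points of consecutive sets, that is, indices
  differing by 1 modulo \<open>p\<close>. Any larger index is reached from such an index by fewer
  than \<open>p\<close> further steps, and these are short.\<close>

lemma orbit_Cauchy:
  assumes step: "(\<lambda>n. d (s n) (s (Suc n))) \<longlonglongrightarrow> 0"
    and close: "\<And>e. e > 0 \<Longrightarrow> \<exists>N. \<forall>q\<ge>N. \<forall>k. d (s q) (s (Suc q + k * p)) < e"
  shows "G_Cauchy G s"
proof (rule G_CauchyI[OF s_X])
  fix e :: real assume "e > 0"
  \<comment> \<open>Two pieces of size \<open>e / 8\<close> keep forward distances below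
    \<open>e / 2\<close>; \<open>d_swap\<close> doubles this for backward ones.\<close>
  then have e8: "e / 8 > 0" by simp
  obtain N1 where N1: "\<And>q k. q \<ge> N1 \<Longrightarrow> d (s q) (s (Suc q + k * p)) < e / 8"
    using close[OF e8] by blast
  have "\<forall>\<^sub>F n in sequentially. \<forall>j\<in>{..p}. d (s n) (s (n + j)) < e / 8"
    using order_tendstoD(2)[OF step_tendsto_mult[OF step] e8] by (intro eventually_ball_finite) auto
  then obtain N2 where N2: "\<And>n j. n \<ge> N2 \<Longrightarrow> j \<le> p \<Longrightarrow> d (s n) (s (n + j)) < e / 8"
    unfolding eventually_sequentially by auto
  have up: "d (s m) (s n) < e / 2" if "m \<ge> max N1 N2" "m \<le> n" for m n
  proof (cases "n = m")
    case True
    then show ?thesis using \<open>e > 0\<close> by (simp add: d_refl s_X)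
  next
    case False
    define k where "k = (n - Suc m) div p"
    define j where "j = (n - Suc m) mod p"
    have "n - Suc m = k * p + j"
      by (simp add: k_def j_def)
    then have n: "n = Suc m + k * p + j"
      using False that by linarith
    have "j \<le> p"
      using p_pos by (simp add: j_def less_imp_le)
    then have "d (s (Suc m + k * p)) (s n) < e / 8"
      unfolding n by (intro N2) (use that in auto)
    moreover have "d (s m) (s (Suc m + k * p)) < e / 8"
      using N1 that by simp
    ultimately show ?thesis
      using d_triangle[OF s_X s_X s_X, of m n "Suc m + k * p"] \<open>e > 0\<close> by linarith
  qed
  have "d (s m) (s n) < e" if "m \<ge> max N1 N2" "n \<ge> max N1 N2" for m n
    using up[of m n] up[of n m] d_swap[OF s_X s_X, of m n] that \<open>e > 0\<close>
    by (cases "m \<le> n") auto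
  then show "\<exists>N. \<forall>m\<ge>N. \<forall>n\<ge>N. d (s m) (s n) < e" by blast
qed

text \<open>For each \<open>n\<close> the subsequence with indices \<open>n + k * p\<close> stays in
  \<open>B n\<close> and has the same limit, so closedness puts the limit into every set.\<close>

lemma orbit_limit:
  assumes "G_Cauchy G s"
  obtains x where "\<And>n. x \<in> B n" "(\<lambda>n. d (s n) x) \<longlonglongrightarrow> 0"
proof -
  obtain x where x: "x \<in> X" "G_converges G s x"
    using complete assms s_X unfolding G_complete_def by blast
  have "x \<in> B n" for n
  proof -
    have "filterlim (\<lambda>k. n + k * p) sequentially sequentially"
      using p_pos by (intro filterlim_subseq) (auto simp: strict_mono_def)
    from G_converges_subseq[OF x(2) this] show ?thesis
      using closed[of n] x(1) s_shift_B unfolding G_closed_def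
      by (elim conjE allE[of _ "\<lambda>k. s (n + k * p)"] allE[of _ x]) simp
  qed
  then show ?thesis
    by (rule that) (rule d_tendsto_swap[OF x(1) s_X G_convergesD[OF x(2)]])
qed

lemma limit_dist_tendsto:
  assumes "(\<lambda>n. d (s n) x) \<longlonglongrightarrow> 0" "x \<in> X" "y \<in> X"
  shows "(\<lambda>n. d (s n) y) \<longlonglongrightarrow> d x y"
proof (rule d_tendsto_cong[where x = "\<lambda>_. x" and y = "\<lambda>_. y"])
  show "(\<lambda>n. d x (s n)) \<longlonglongrightarrow> 0"
    by (rule d_tendsto_swap[OF s_X assms(2,1)])
qed (simp_all add: assms s_X d_refl)

section \<open>The two contractive conditions\<close>

text \<open>The right-hand side contains only distances from a point to its image. On the orbit
  these are steps, so once steps vanish, points of consecutive sets are close by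
  \<open>contr_le\<close> alone.\<close>

lemma fixed_point_condition_1:
  assumes coef: "0 \<le> \<beta>" "\<beta> < 1" "\<alpha> + \<beta> \<le> 1"
    and C: "\<And>n x y. x \<in> B n \<Longrightarrow> y \<in> B (Suc n) \<Longrightarrow> contr (d (T x) (T y)) (d x (T x)) (d y (T y))"
  shows "\<exists>u. (\<forall>n. u \<in> B n) \<and> T u = u \<and> (\<forall>n. \<forall>v\<in>B n. T v = v \<longrightarrow> v = u)"
proof -
  have C_step: "contr (d (s (Suc n)) (s (Suc (Suc n)))) (d (s n) (s (Suc n)))
      (d (s (Suc n)) (s (Suc (Suc n))))" for n
    using C[OF s_B s_B, of n] by (simp add: s_Suc)
  \<comment> \<open>The new step occurs on both sides of \<open>contr_le\<close>; it is collected on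
    the left and \<open>1 - \<beta> > 0\<close> is cancelled. As \<alpha> may be negative, it is
    only bounded above, by \<open>1 - \<beta>\<close>.\<close>
  have "d (s (Suc n)) (s (Suc (Suc n))) \<le> d (s n) (s (Suc n))" for n
  proof -
    have "(1 - \<beta>) * d (s (Suc n)) (s (Suc (Suc n))) \<le> \<alpha> * d (s n) (s (Suc n))"
      using contr_le[OF C_step[of n]] by (simp add: algebra_simps)
    also have "\<dots> \<le> (1 - \<beta>) * d (s n) (s (Suc n))"
      using coef by (intro mult_right_mono G_nonneg s_X) auto
    finally show ?thesis using coef by simp
  qed
  then obtain r where r: "r \<ge> 0" "(\<lambda>n. d (s n) (s (Suc n))) \<longlonglongrightarrow> r"
    "(\<lambda>n. d (s (Suc n)) (s (Suc (Suc n)))) \<longlonglongrightarrow> r"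
    by (rule step_tendsto_0)
  have "\<alpha> * r + \<beta> * r \<le> r"
    using mult_right_mono[OF coef(3) r(1)] by (simp add: algebra_simps)
  then have "r = 0"
    using contr_lim[OF C_step r(3,2,3)] by simp
  with r have step: "(\<lambda>n. d (s n) (s (Suc n))) \<longlonglongrightarrow> 0" by simp
  have "\<exists>N. \<forall>q\<ge>N. \<forall>k. d (s q) (s (Suc q + k * p)) < e" if "e > 0" for e
  proof -
    have "e / 2 > 0" using that by simp
    then obtain N where N: "\<And>n. n \<ge> N \<Longrightarrow> d (s n) (s (Suc n)) < e / 2"
      using order_tendstoD(2)[OF step] unfolding eventually_sequentially by blast
    \<comment> \<open>The contraction bounds distances of images, so closeness starts at index
      \<open>Suc N\<close>, where every index is a successor.\<close>
    have "d (s (Suc q)) (s (Suc (Suc q) + k * p)) < e" if "q \<ge> N" for q k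
    proof -
      let ?r = "Suc q + k * p"
      have "d (s (Suc q)) (s (Suc ?r)) \<le> \<alpha> * d (s q) (s (Suc q)) + \<beta> * d (s ?r) (s (Suc ?r))"
        using contr_le[OF C[OF s_B s_shift_B, of q k]] by (simp add: s_Suc)
      also have "\<dots> \<le> 1 * d (s q) (s (Suc q)) + 1 * d (s ?r) (s (Suc ?r))"
        using coef by (intro add_mono mult_right_mono G_nonneg s_X) auto
      also have "\<dots> < e"
        using N[of q] N[of ?r] that by auto
      finally show ?thesis by simp
    qed
    then show ?thesis
      by (metis Suc_le_D Suc_le_mono)
  qed
  from orbit_limit[OF orbit_Cauchy[OF step this]]
  obtain x where x: "\<And>n. x \<in> B n" "(\<lambda>n. d (s n) x) \<longlonglongrightarrow> 0" by blast
  have xX: "x \<in> X" "T x \<in> X" using x(1) B_X T_X by blast+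
  have lim: "(\<lambda>n. d (s (Suc n)) (T x)) \<longlonglongrightarrow> d x (T x)"
    using LIMSEQ_Suc[OF limit_dist_tendsto[OF x(2) xX]] .
  \<comment> \<open>Since \<open>x\<close> lies in every set of the cycle, it may be paired with
    each \<open>s n\<close>. In the limit both \<open>a\<close> and \<open>v\<close> become
    \<open>d x (T x)\<close>, while \<open>u\<close> vanishes.\<close>
  have c: "contr (d (s (Suc n)) (T x)) (d (s n) (s (Suc n))) (d x (T x))" for n
    using C[OF s_B x(1), of n] by (simp add: s_Suc)
  have "\<alpha> * 0 + \<beta> * d x (T x) \<le> d x (T x)"
    using mult_right_mono[of \<beta> 1 "d x (T x)"] coef G_nonneg[of x "T x" "T x"] xX by simp
  then have "d x (T x) = 0"
    using contr_lim[OF c lim step tendsto_const] by simp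
  then have "T x = x"
    using d_eq_0 xX by metis
  moreover have "v = x" if "v \<in> B n" "T v = v" for n v
  proof -
    have "d v x \<le> 0"
      using contr_le[OF C[OF that(1) x(1)]] that \<open>T x = x\<close> B_X xX by (simp add: d_refl)
    then show ?thesis
      using d_eq_0 G_nonneg that B_X xX by (meson antisym)
  qed
  ultimately show ?thesis using x(1) by blast
qed

text \<open>Here the right-hand side contains cross distances as large as the left-hand one, and
  \<alpha> + \<beta> may be 1. Closeness is therefore proved by contradiction, along pairs of orbit
  points whose distance tends to \<open>e\<close>.\<close>

lemma fixed_point_condition_2:
  assumes coef: "0 \<le> \<alpha>" "\<alpha> \<le> 1 / 2" "\<alpha> + \<beta> \<le> 1"
    and C: "\<And>n x y. x \<in> B n \<Longrightarrow> y \<in> B (Suc n) \<Longrightarrow> contr (d (T x) (T y)) (d x (T y)) (d (T x) y)"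
  shows "\<exists>u. (\<forall>n. u \<in> B n) \<and> T u = u \<and> (\<forall>n. \<forall>v\<in>B n. T v = v \<longrightarrow> v = u)"
proof -
  \<comment> \<open>For \<open>x = s n\<close> and \<open>y = s (Suc n)\<close> one has
    \<open>T x = y\<close>, so the \<beta>-term vanishes.\<close>
  have C_step: "contr (d (s (Suc n)) (s (Suc (Suc n)))) (d (s n) (s (Suc (Suc n)))) 0" for n
    using C[OF s_B s_B, of n] by (simp add: s_Suc[symmetric] d_refl s_X)
  have two: "2 * d (s (Suc n)) (s (Suc (Suc n))) \<le> d (s n) (s (Suc (Suc n)))" for n
    using contr_le[OF C_step[of n]] mult_right_mono[OF coef(2) G_nonneg[OF s_X s_X s_X],
        of n "Suc (Suc n)" "Suc (Suc n)"] by simp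
  have tri: "d (s n) (s (Suc (Suc n))) \<le> d (s n) (s (Suc n)) + d (s (Suc n)) (s (Suc (Suc n)))" for n
    by (intro d_triangle s_X)
  have "d (s (Suc n)) (s (Suc (Suc n))) \<le> d (s n) (s (Suc n))" for n
    using two[of n] tri[of n] by linarith
  then obtain r where r: "r \<ge> 0" "(\<lambda>n. d (s n) (s (Suc n))) \<longlonglongrightarrow> r"
    "(\<lambda>n. d (s (Suc n)) (s (Suc (Suc n)))) \<longlonglongrightarrow> r"
    by (rule step_tendsto_0)
  \<comment> \<open>The two-step distance lies between twice the later step and the sum of both
    steps. Its limit \<open>2 * r\<close> is what \<open>\<alpha> \<le> 1 / 2\<close> can
    absorb.\<close>
  have "(\<lambda>n. d (s n) (s (Suc (Suc n)))) \<longlonglongrightarrow> 2 * r"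
  proof (rule tendsto_sandwich)
    show "(\<lambda>n. 2 * d (s (Suc n)) (s (Suc (Suc n)))) \<longlonglongrightarrow> 2 * r"
      by (intro tendsto_intros r)
    show "(\<lambda>n. d (s n) (s (Suc n)) + d (s (Suc n)) (s (Suc (Suc n)))) \<longlonglongrightarrow> 2 * r"
      using tendsto_add[OF r(2,3)] by simp
  qed (use two tri in auto)
  moreover have "\<alpha> * (2 * r) + \<beta> * 0 \<le> r"
    using mult_right_mono[OF coef(2) r(1)] by simp
  ultimately have "r = 0"
    using contr_lim[OF C_step r(3) _ tendsto_const] by force
  with r have step: "(\<lambda>n. d (s n) (s (Suc n))) \<longlonglongrightarrow> 0" by simp
  have "\<exists>N. \<forall>q\<ge>N. \<forall>k. d (s q) (s (Suc q + k * p)) < e" if e: "e > 0" for e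
  proof (rule ccontr)
    assume far: "\<not> ?thesis"
    obtain N where N: "\<And>n. n \<ge> N \<Longrightarrow> d (s n) (s (Suc n)) < e"
      using order_tendstoD(2)[OF step e] unfolding eventually_sequentially by blast
    text \<open>
      Take the first index in the progression at distance at least \<open>e\<close>: then the
      distance is \<open>e + o(1)\<close>.
    \<close>
    have "\<exists>q m. q \<ge> n \<and> d (s q) (s (Suc q + m * p)) < e \<and> e \<le> d (s q) (s (Suc q + Suc m * p))" for n
    proof -
      obtain q k where qk: "q \<ge> max n N" "e \<le> d (s q) (s (Suc q + k * p))"
        using far by (meson not_less)
      define l where "l = (LEAST k. e \<le> d (s q) (s (Suc q + k * p)))"
      have l: "e \<le> d (s q) (s (Suc q + l * p))"
        unfolding l_def by (rule LeastI) (rule qk)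
      \<comment> \<open>For \<open>k = 0\<close> the distance is a single step, below
        \<open>e\<close> from \<open>N\<close> on; so the least index has a predecessor.\<close>
      have "l \<noteq> 0"
        using l N[of q] qk(1) by (metis add.right_neutral max.boundedE mult_0 not_le)
      then obtain m where m: "l = Suc m" using not0_implies_Suc by blast
      then have "d (s q) (s (Suc q + m * p)) < e"
        using not_less_Least[of m "\<lambda>k. e \<le> d (s q) (s (Suc q + k * p))"] by (simp add: l_def)
      with l m qk(1) show ?thesis by auto
    qed
    then obtain q m where q: "\<And>n. q n \<ge> n"
      and below: "\<And>n. d (s (q n)) (s (Suc (q n) + m n * p)) < e"
      and above: "\<And>n. e \<le> d (s (q n)) (s (Suc (q n) + Suc (m n) * p))"
      by metis
    define t where "t n = Suc (q n) + m n * p" for n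
    define r where "r n = Suc (q n) + Suc (m n) * p" for n
    have r_t: "r n = t n + p" for n by (simp add: r_def t_def)
    have q_lim: "filterlim q sequentially sequentially"
      using q by (intro filterlim_at_top_mono[OF filterlim_ident]) auto
    have "t n \<ge> n" for n using q[of n] by (simp add: t_def)
    then have t_lim: "filterlim t sequentially sequentially"
      by (intro filterlim_at_top_mono[OF filterlim_ident]) auto
    have "r n \<ge> n" for n using q[of n] by (simp add: r_def)
    then have r_lim: "filterlim r sequentially sequentially"
      by (intro filterlim_at_top_mono[OF filterlim_ident]) auto
    note q_step = filterlim_compose[OF step q_lim] and r_step = filterlim_compose[OF step r_lim]
    have lim: "(\<lambda>n. d (s (q n)) (s (r n))) \<longlonglongrightarrow> e"
    proof (rule tendsto_sandwich[where f = "\<lambda>_. e"])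
      show "(\<lambda>n. e + d (s (t n)) (s (t n + p))) \<longlonglongrightarrow> e"
        using tendsto_add[OF tendsto_const filterlim_compose[OF step_tendsto_mult[OF step] t_lim]]
        by simp
      have "d (s (q n)) (s (r n)) \<le> e + d (s (t n)) (s (t n + p))" for n
        using d_triangle[OF s_X s_X s_X, of "q n" "r n" "t n"] below[of n]
        by (simp add: r_t) (simp add: t_def)
      then show "\<forall>\<^sub>F n in sequentially. d (s (q n)) (s (r n)) \<le> e + d (s (t n)) (s (t n + p))"
        by simp
    qed (use above in \<open>auto simp: r_def\<close>)
    \<comment> \<open>The index \<open>r n\<close> exceeds \<open>q n\<close> by 1 modulo
      \<open>p\<close>, so the condition applies to this pair. Its three distances differ from
      \<open>d (s (q n)) (s (r n))\<close> by vanishing steps, hence all tend to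
      \<open>e\<close>.\<close>
    have c: "contr (d (s (Suc (q n))) (s (Suc (r n)))) (d (s (q n)) (s (Suc (r n))))
            (d (s (Suc (q n))) (s (r n)))" for n
      using C[OF s_B s_shift_B, of "q n" "Suc (m n)"] unfolding r_def s_Suc .
    have lim_a: "(\<lambda>n. d (s (Suc (q n))) (s (Suc (r n)))) \<longlonglongrightarrow> e"
      by (rule d_tendsto_cong[OF _ _ _ _ q_step r_step lim]) (auto simp: s_X)
    have lim_u: "(\<lambda>n. d (s (q n)) (s (Suc (r n)))) \<longlonglongrightarrow> e"
      by (rule d_tendsto_cong[OF _ _ _ _ _ r_step lim]) (auto simp: s_X d_refl)
    have lim_v: "(\<lambda>n. d (s (Suc (q n))) (s (r n))) \<longlonglongrightarrow> e"
      by (rule d_tendsto_cong[OF _ _ _ _ q_step _ lim]) (auto simp: s_X d_refl)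
    have "\<alpha> * e + \<beta> * e \<le> e"
      using mult_right_mono[OF coef(3), of e] e by (simp add: algebra_simps)
    then have "e = 0" using contr_lim[OF c lim_a lim_u lim_v] by simp
    with e show False by simp
  qed
  from orbit_limit[OF orbit_Cauchy[OF step this]]
  obtain x where x: "\<And>n. x \<in> B n" "(\<lambda>n. d (s n) x) \<longlonglongrightarrow> 0" by blast
  have xX: "x \<in> X" "T x \<in> X" using x(1) B_X T_X by blast+
  have lim: "(\<lambda>n. d (s n) (T x)) \<longlonglongrightarrow> d x (T x)"
    using limit_dist_tendsto[OF x(2) xX] .
  have c: "contr (d (s (Suc n)) (T x)) (d (s n) (T x)) (d (s (Suc n)) x)" for n
    using C[OF s_B x(1), of n] by (simp add: s_Suc)
  have "\<alpha> * d x (T x) + \<beta> * 0 \<le> d x (T x)"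
    using mult_right_mono[of \<alpha> 1 "d x (T x)"] coef G_nonneg[of x "T x" "T x"] xX by simp
  then have "d x (T x) = 0"
    using contr_lim[OF c LIMSEQ_Suc[OF lim] lim LIMSEQ_Suc[OF x(2)]] by simp
  then have "T x = x"
    using d_eq_0 xX by metis
  moreover have "v = x" if v: "v \<in> B n" "T v = v" for n v
  proof -
    \<comment> \<open>For two fixed points all three distances coincide. If \<alpha> + \<beta> = 1,
      \<open>contr_le\<close> says nothing here; the \<psi>-term behind \<open>contr_zero\<close>
      decides.\<close>
    have c: "contr (d v x) (d v x) (d v x)"
      using C[OF v(1) x(1)] v(2) \<open>T x = x\<close> by simp
    then have "\<alpha> * d v x + \<beta> * d v x \<le> d v x"
      using mult_right_mono[OF coef(3), of "d v x"] by (simp add: algebra_simps contr_def)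
    with contr_zero[OF c] have "d v x = 0" by simp
    then show ?thesis
      using d_eq_0 v B_X xX by blast
  qed
  ultimately show ?thesis using x(1) by blast
qed

end

section \<open>Re-indexing the cycle and applying the two cases\<close>

theorem theorem2p1:
  fixes X :: "'a set" and G :: "'a \<Rightarrow> 'a \<Rightarrow> 'a \<Rightarrow> real"
    and p :: nat and A :: "nat \<Rightarrow> 'a set" and T :: "'a \<Rightarrow> 'a"
    and \<phi> :: "real \<Rightarrow> real" and \<psi> :: "real \<Rightarrow> real \<Rightarrow> real \<Rightarrow> real"
  assumes "G_metric_space X G" and "G_complete X G"
    and "p \<ge> 1"
    and "\<And>i. i \<in> {1..p} \<Longrightarrow> A i \<noteq> {} \<and> G_closed X G (A i)"
    and "A (p + 1) = A 1"
    and "cyclical_operator p A T"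
    and "altering_distance \<phi>"
    and "\<And>x y z. x \<ge> 0 \<Longrightarrow> y \<ge> 0 \<Longrightarrow> z \<ge> 0 \<Longrightarrow> \<psi> x y z \<ge> 0"
    and "continuous_on ({0..} \<times> {0..} \<times> {0..}) (\<lambda>(x, y, z). \<psi> x y z)"
    and "\<And>x y z. x \<ge> 0 \<Longrightarrow> y \<ge> 0 \<Longrightarrow> z \<ge> 0 \<Longrightarrow>
           \<psi> x y z = 0 \<longleftrightarrow> x = 0 \<and> y = 0 \<and> z = 0"
    and "(\<exists>\<alpha> \<gamma> :: real. 0 \<le> \<gamma> \<and> \<gamma> < 1 \<and> 0 < \<alpha> + \<gamma> \<and> \<alpha> + \<gamma> \<le> 1 \<and>
            (\<forall>i\<in>{1..p}. \<forall>x\<in>A i. \<forall>y\<in>A (i + 1).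
               0 \<le> \<alpha> * G x (T x) (T x) + \<gamma> * G y (T y) (T y) \<and>
               \<phi> (G (T x) (T y) (T y))
                 \<le> \<phi> (\<alpha> * G x (T x) (T x) + \<gamma> * G y (T y) (T y))
                    - \<psi> (G x (T x) (T x)) (G y (T y) (T y)) (G y (T y) (T y))))
       \<or> (\<exists>\<alpha> \<delta> :: real. 0 \<le> \<alpha> \<and> \<alpha> \<le> 1 / 2 \<and> 0 < \<alpha> + \<delta> \<and> \<alpha> + \<delta> \<le> 1 \<and>
            (\<forall>i\<in>{1..p}. \<forall>x\<in>A i. \<forall>y\<in>A (i + 1).
               0 \<le> \<alpha> * G x (T y) (T y) + \<delta> * G y y (T x) \<and>
               \<phi> (G (T x) (T y) (T y))
                 \<le> \<phi> (\<alpha> * G x (T y) (T y) + \<delta> * G y y (T x))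
                    - \<psi> (G x (T y) (T y)) (G y y (T x)) (G y y (T x))))"
  shows "\<exists>u. (u \<in> (\<Union>i\<in>{1..p}. A i) \<and> T u = u) \<and>
             (\<forall>v \<in> (\<Union>i\<in>{1..p}. A i). T v = v \<longrightarrow> v = u) \<and>
             u \<in> (\<Inter>i\<in>{1..p}. A i)"
proof -
  define B where "B n = A (1 + n mod p)" for n
  have p: "p > 0" using assms(3) by simp
  have idx: "1 + n mod p \<in> {1..p}" for n
    using mod_less_divisor[OF p, of n] by auto
  \<comment> \<open>When \<open>n mod p = p - 1\<close>, the left side is \<open>A 1\<close> and the
    right side \<open>A (p + 1)\<close>; the convention identifies them.\<close>
  have B_Suc: "B (Suc n) = A (1 + n mod p + 1)" for n
    using assms(5) by (auto simp: B_def mod_Suc)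
  have A_B: "A i = B (i - 1)" if "i \<in> {1..p}" for i
    using that by (auto simp: B_def)
  obtain x0 where "x0 \<in> B 0"
    using assms(4)[OF idx[of 0]] by (auto simp: B_def)
  define s where "s n = (T ^^ n) x0" for n
  \<comment> \<open>The locale assumptions do not mention \<alpha> and \<beta>, so the locale
    predicate does not take them, and this one fact serves both conditions.\<close>
  have orbit: "cyclic_orbit X G \<phi> \<psi> B T p s"
  proof
    have T_A: "T ` A (1 + n mod p) \<subseteq> A (1 + n mod p + 1)" for n
      using assms(6) idx[of n] unfolding cyclical_operator_def by (elim conjE bspec)
    show "T x \<in> B (Suc n)" if "x \<in> B n" for n x
      unfolding B_Suc by (rule subsetD[OF T_A imageI]) (use that in \<open>simp add: B_def\<close>)
    show "G_closed X G (B n)" for n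
      using assms(4)[OF idx[of n]] by (simp add: B_def)
    show "s 0 \<in> B 0" using \<open>x0 \<in> B 0\<close> by (simp add: s_def)
  qed (fact assms | simp add: B_def s_def)+
  then interpret G_space X G by (simp add: cyclic_orbit_def)
  have X: "x \<in> X" "T x \<in> X" if "x \<in> B n" for n x
    using cyclic_orbit.B_X[OF orbit that] cyclic_orbit.T_X[OF orbit that] .
  have "\<exists>u. (\<forall>n. u \<in> B n) \<and> T u = u \<and> (\<forall>n. \<forall>v\<in>B n. T v = v \<longrightarrow> v = u)"
    using assms(11)
  proof (elim disjE exE conjE)
    fix \<alpha> \<gamma>
    assume coef: "0 \<le> \<gamma>" "\<gamma> < 1" "\<alpha> + \<gamma> \<le> 1"
      and C: "\<forall>i\<in>{1..p}. \<forall>x\<in>A i. \<forall>y\<in>A (i + 1).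
               0 \<le> \<alpha> * G x (T x) (T x) + \<gamma> * G y (T y) (T y) \<and>
               \<phi> (G (T x) (T y) (T y))
                 \<le> \<phi> (\<alpha> * G x (T x) (T x) + \<gamma> * G y (T y) (T y))
                    - \<psi> (G x (T x) (T x)) (G y (T y) (T y)) (G y (T y) (T y))"
    interpret cyclic_orbit X G \<phi> \<psi> \<alpha> \<gamma> B T p s by (rule orbit)
    show ?thesis
    proof (rule fixed_point_condition_1[OF coef])
      fix n x y assume xy: "x \<in> B n" "y \<in> B (Suc n)"
      then show "contr (d (T x) (T y)) (d x (T x)) (d y (T y))"
        using C[rule_format, OF idx[of n], folded B_Suc, folded B_def, OF xy]
          X[OF xy(1)] X[OF xy(2)] G_nonneg
        unfolding contr_def by simp
    qed
  next
    fix \<alpha> \<delta> :: real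
    assume coef: "0 \<le> \<alpha>" "\<alpha> \<le> 1 / 2" "\<alpha> + \<delta> \<le> 1"
      and C: "\<forall>i\<in>{1..p}. \<forall>x\<in>A i. \<forall>y\<in>A (i + 1).
               0 \<le> \<alpha> * G x (T y) (T y) + \<delta> * G y y (T x) \<and>
               \<phi> (G (T x) (T y) (T y))
                 \<le> \<phi> (\<alpha> * G x (T y) (T y) + \<delta> * G y y (T x))
                    - \<psi> (G x (T y) (T y)) (G y y (T x)) (G y y (T x))"
    interpret cyclic_orbit X G \<phi> \<psi> \<alpha> \<delta> B T p s by (rule orbit)
    show ?thesis
    proof (rule fixed_point_condition_2[OF coef])
      fix n x y assume xy: "x \<in> B n" "y \<in> B (Suc n)"
      have "G y y (T x) = d (T x) y"
        using X xy by (intro G_rotate)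
      then show "contr (d (T x) (T y)) (d x (T y)) (d (T x) y)"
        using C[rule_format, OF idx[of n], folded B_Suc, folded B_def, OF xy]
          X[OF xy(1)] X[OF xy(2)] G_nonneg
        unfolding contr_def by simp
    qed
  qed
  then obtain u where u: "\<And>n. u \<in> B n" "T u = u" "\<And>n v. v \<in> B n \<Longrightarrow> T v = v \<Longrightarrow> v = u"
    by blast
  have "1 \<in> {1..p}" using assms(3) by simp
  then have "u \<in> (\<Union>i\<in>{1..p}. A i)"
    using u(1) A_B by blast
  moreover have "v = u" if "v \<in> (\<Union>i\<in>{1..p}. A i)" "T v = v" for v
    using that u(3) A_B by blast
  moreover have "u \<in> (\<Inter>i\<in>{1..p}. A i)"
    using u(1) A_B by blast
  ultimately show ?thesis using u(2) by blast
qed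

end
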